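(* Let $X$ be a Hausdorff locally convex topological vector space with dual $X^*$, and let $e,e'$ be error functions on $X\times X$. Let $f:X\to\mathbb{R}\cup\{+\infty\}$ be $e$-convex with $e(x,x)=0$ for all $x\in\operatorname{dom} f$, and let $g:X\to\mathbb{R}\cup\{+\infty\}$ be $e'$-convex with $e'(z,z)=0$ for each $z\in\operatorname{dom} g$. Suppose that $f$ and $g$ are locally bounded above on $\operatorname{int}(\operatorname{dom} f)$ and $\operatorname{int}(\operatorname{dom} g)$, respectively, and that $e(\cdot,x)|_{\operatorname{dom} f}$ and $e'(\cdot,z)|_{\operatorname{dom} g}$ are upper semicontinuous for all $x\in\operatorname{dom} f$ and $z\in\operatorname{dom} g$. Then: (i) for every $y\in X$ and $x^*\in X^*$, $$(f+g)^*_{e+e',y}(x^* )\le\left(f^*_{e,y}\,\square\,g^*_{e',y}\right)(x^* );$$ (ii) if $e|_{\operatorname{dom} f\times\operatorname{dom} f}$ and $e'|_{\operatorname{dom} g\times\operatorname{dom} g}$ are locally bounded, $y\in\operatorname{int}(\operatorname{dom} f)\cap\operatorname{int}(\operatorname{dom} g)$, and $y$ is a local minimum point of the function $f+g-\langle x^*,\cdot\rangle$, then equality holds, i.e. $(f+g)^*_{e+e',y}(x^* )=(f^*_{e,y}\,\square\,g^*_{e',y})(x^* )$.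
   Context: $\operatorname{dom} f=\{x: f(x)<+\infty\}$. An error function is a map $e:X\times X\to\mathbb{R}\cup\{+\infty\}$ that is nonnegative, symmetric, and has nonempty domain $\operatorname{dom} e=\{(x,y): e(x,y)<+\infty\}$. $f$ is $e$-convex if $\operatorname{dom} f\times\operatorname{dom} f\subset\operatorname{dom} e$ and $f(tx+(1-t)y)\le tf(x)+(1-t)f(y)+t(1-t)e(x,y)$ for all $x,y\in X$, $t\in\,]0,1[$. For fixed $y\in X$ the $(e,y)$-conjugate is $f^*_{e,y}(x^* )=\sup_{x\in X}\{\langle x^*,x\rangle-f(x)-e(x,y)\}$, $x^*\in X^*$ (and likewise for $g,e'$ and for $f+g,e+e'$). The infimal convolution of two extended-real-valued functions $\varphi,\psi$ on $X^*$ is $(\varphi\,\square\,\psi)(x^* )=\inf\{\varphi(x_1^* )+\psi(x_2^* ): x^*=x_1^*+x_2^*\}$. Convention: $(+\infty)+(-\infty)=(-\infty)+(+\infty)=-\infty$. Locally bounded (above) on a set means that every point of the set has a neighborhood on whose intersection with the set the function is bounded (above). *)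

theory Defs
  imports "HOL-Analysis.Analysis"
begin

text \<open>Hausdorff locally convex topological vector spaces over the reals. The class
  specification has to unfold \<open>convex\<close>, a constant that lives outside the class context.\<close>

class locally_convex_space = real_vector + topological_ab_group_add + t2_space +
  assumes tendsto_scaleR_Pair:
    "LIM p (nhds (c::real) \<times>\<^sub>F nhds (x::'a)). fst p *\<^sub>R snd p :> nhds (c *\<^sub>R x)"
  and locally_convex:
    "open U \<Longrightarrow> x \<in> U \<Longrightarrow> \<exists>V. open V \<and> x \<in> V \<and> V \<subseteq> U \<and>
       (\<forall>y\<in>V. \<forall>z\<in>V. \<forall>u\<ge>0. \<forall>v\<ge>0. u + v = 1 \<longrightarrow> u *\<^sub>R y + v *\<^sub>R z \<in> V)"

lemma open_convex_neighbourhood: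
  fixes x :: "'a::locally_convex_space"
  assumes "open U" "x \<in> U"
  shows "\<exists>V. open V \<and> convex V \<and> x \<in> V \<and> V \<subseteq> U"
  using locally_convex[OF assms] unfolding convex_def by blast

instance real_normed_vector \<subseteq> locally_convex_space
proof
  fix c :: real and x :: 'a
  have "((\<lambda>p. fst p *\<^sub>R snd p) \<longlongrightarrow> c *\<^sub>R x) (nhds c \<times>\<^sub>F nhds x)"
    by (intro tendsto_scaleR filterlim_fst filterlim_snd)
  then show "LIM p (nhds c \<times>\<^sub>F nhds x). fst p *\<^sub>R snd p :> nhds (c *\<^sub>R x)" .
next
  fix U :: "'a set" and x :: 'a
  assume "open U" "x \<in> U"
  then obtain r where "r > 0" "ball x r \<subseteq> U"
    by (auto simp: open_contains_ball)
  then show "\<exists>V. open V \<and> x \<in> V \<and> V \<subseteq> U \<and>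
      (\<forall>y\<in>V. \<forall>z\<in>V. \<forall>u\<ge>0. \<forall>v\<ge>0. u + v = 1 \<longrightarrow> u *\<^sub>R y + v *\<^sub>R z \<in> V)"
    using convex_ball[of x r] unfolding convex_def
    by (intro exI[of _ "ball x r"] conjI) auto
qed

definition dual_space :: "('a::locally_convex_space \<Rightarrow> real) set" where
  "dual_space = {\<phi>. linear \<phi> \<and> continuous_on UNIV \<phi>}"

definition edom :: "('a \<Rightarrow> ereal) \<Rightarrow> 'a set" where
  "edom f = {x. f x < \<infinity>}"

definition error_function :: "('a \<times> 'a \<Rightarrow> ereal) \<Rightarrow> bool" where
  "error_function e \<longleftrightarrow>
     (\<forall>x y. 0 \<le> e (x, y)) \<and> (\<forall>x y. e (x, y) = e (y, x)) \<and> edom e \<noteq> {}"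

definition e_convex :: "('a::real_vector \<times> 'a \<Rightarrow> ereal) \<Rightarrow> ('a \<Rightarrow> ereal) \<Rightarrow> bool" where
  "e_convex e f \<longleftrightarrow>
     edom f \<times> edom f \<subseteq> edom e \<and>
     (\<forall>x y. \<forall>t\<in>{0<..<1::real}.
        f (t *\<^sub>R x + (1 - t) *\<^sub>R y) \<le>
          ereal t * f x + ereal (1 - t) * f y + ereal (t * (1 - t)) * e (x, y))"

text \<open>
  For \<open>f\<close> and \<open>e\<close> not taking the value \<open>-\<infinity>\<close>, no sum of opposite infinities occurs
  in the following supremum.
\<close>

definition e_conjugate ::
    "('a \<times> 'a \<Rightarrow> ereal) \<Rightarrow> 'a \<Rightarrow> ('a \<Rightarrow> ereal) \<Rightarrow> ('a \<Rightarrow> real) \<Rightarrow> ereal" where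
  "e_conjugate e y f \<phi> = (SUP x. ereal (\<phi> x) - f x - e (x, y))"

text \<open>
  In the library \<open>\<infinity> + (-\<infinity>) = \<infinity>\<close> on \<open>ereal\<close>. The addition used in the infimal
  convolution has \<open>\<infinity> + (-\<infinity>) = (-\<infinity>) + \<infinity> = -\<infinity>\<close> instead. The difference matters, since
  a conjugate is identically \<open>-\<infinity>\<close> when \<open>f x + e (x, y) = \<infinity>\<close> for all \<open>x\<close>, while the
  other conjugate may take the value \<open>\<infinity>\<close>.
\<close>

definition lower_add :: "ereal \<Rightarrow> ereal \<Rightarrow> ereal" where
  "lower_add a b = (if a = -\<infinity> \<or> b = -\<infinity> then -\<infinity> else a + b)"

definition inf_convolution ::
    "(('a::locally_convex_space \<Rightarrow> real) \<Rightarrow> ereal) \<Rightarrow> (('a \<Rightarrow> real) \<Rightarrow> ereal) \<Rightarrow>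
     ('a \<Rightarrow> real) \<Rightarrow> ereal" where
  "inf_convolution F G \<phi> =
     Inf {lower_add (F \<phi>1) (G \<phi>2) | \<phi>1 \<phi>2.
       \<phi>1 \<in> dual_space \<and> \<phi>2 \<in> dual_space \<and> \<phi> = (\<lambda>x. \<phi>1 x + \<phi>2 x)}"

definition locally_bounded_above_on :: "'a::topological_space set \<Rightarrow> ('a \<Rightarrow> ereal) \<Rightarrow> bool" where
  "locally_bounded_above_on S f \<longleftrightarrow>
     (\<forall>x\<in>S. \<exists>U. open U \<and> x \<in> U \<and> (\<exists>M::real. \<forall>z\<in>U \<inter> S. f z \<le> ereal M))"

definition locally_bounded_on :: "'a::topological_space set \<Rightarrow> ('a \<Rightarrow> ereal) \<Rightarrow> bool" where
  "locally_bounded_on S f \<longleftrightarrow>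
     (\<forall>x\<in>S. \<exists>U. open U \<and> x \<in> U \<and> (\<exists>M::real. \<forall>z\<in>U \<inter> S. \<bar>f z\<bar> \<le> ereal M))"

text \<open>Upper semicontinuity of the restriction of \<open>h\<close> to \<open>S\<close> with the subspace topology.\<close>

definition usc_on :: "'a::topological_space set \<Rightarrow> ('a \<Rightarrow> ereal) \<Rightarrow> bool" where
  "usc_on S h \<longleftrightarrow> (\<forall>x\<in>S. \<forall>a>h x. \<forall>\<^sub>F z in at x within S. h z < a)"

definition local_minimum_point :: "('a::topological_space \<Rightarrow> ereal) \<Rightarrow> 'a \<Rightarrow> bool" where
  "local_minimum_point h y \<longleftrightarrow> (\<forall>\<^sub>F x in nhds y. h y \<le> h x)"

end

theory Submission
  imports Defs
begin

text \<open>
  The inequality (i) is a pointwise estimate. For (ii), \<open>e\<close>-convexity and local boundedness make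
  \<open>f\<close> and \<open>g\<close> Lipschitz near \<open>y\<close>, so their Clarke directional derivatives \<open>f\<degree>(y; \<cdot>)\<close> and \<open>g\<degree>(y; \<cdot>)\<close>
  are finite sublinear functionals that are bounded above near \<open>0\<close>. Local minimality gives
  \<open>\<phi> \<le> f\<degree>(y; \<cdot>) + g\<degree>(y; \<cdot>)\<close>, and by the Hahn-Banach theorem \<open>\<phi> = \<phi>1 + \<phi>2\<close> with \<open>\<phi>1 \<le> f\<degree>(y; \<cdot>)\<close>,
  \<open>\<phi>2 \<le> g\<degree>(y; \<cdot>)\<close>, both continuous. Upper semicontinuity of \<open>e(\<cdot>, x)\<close> and the Lipschitz property
  yield \<open>f\<degree>(y; x - y) \<le> f x - f y + e(x, y)\<close>, so the conjugate of \<open>f\<close> at \<open>\<phi>1\<close> is at most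
  \<open>\<phi>1 y - f y\<close>, and similarly for \<open>g\<close>. The two bounds add up to the value at \<open>x = y\<close> of the supremum
  that defines the conjugate of \<open>f + g\<close> at \<open>\<phi>\<close>.
\<close>

section \<open>Sublinear functionals\<close>

text \<open>The inequality for \<open>c * x\<close> is an equality, also for \<open>c = 0\<close>, by using it for \<open>1 / c\<close>.\<close>

definition sublinear :: "('a::real_vector \<Rightarrow> real) \<Rightarrow> bool" where
  "sublinear p \<longleftrightarrow> (\<forall>x y. p (x + y) \<le> p x + p y) \<and> (\<forall>c>0. \<forall>x. p (c *\<^sub>R x) \<le> c * p x)"

lemma sublinearD:
  assumes "sublinear p"
  shows sublinear_add: "p (x + y) \<le> p x + p y"
    and sublinear_zero: "p 0 = 0"
    and sublinear_scaleR: "0 \<le> c \<Longrightarrow> p (c *\<^sub>R x) = c * p x"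
proof -
  show add: "p (x + y) \<le> p x + p y" for x y
    using assms by (simp add: sublinear_def)
  have le: "p (c *\<^sub>R x) \<le> c * p x" if "0 < c" for c x
    using assms that by (simp add: sublinear_def)
  \<comment> \<open>The factors 2 and 1/2 give \<open>p 0 \<le> 2 * p 0\<close> and
    \<open>p 0 \<le> p 0 / 2\<close>, hence both signs.\<close>
  show 0: "p 0 = 0"
    using le[of 2 0] le[of "1/2" 0] by simp
  show "p (c *\<^sub>R x) = c * p x" if "0 \<le> c" for c x
  proof (cases "c = 0")
    case False
    with that have "p x \<le> p (c *\<^sub>R x) / c"
      using le[of "1 / c" "c *\<^sub>R x"] by simp
    with le[of c x] that False show ?thesis
      by (simp add: field_simps)
  qed (simp add: 0)
qed

text \<open>No lower bound on the sets has to be assumed: elements of \<open>A x\<close> and \<open>A (- x)\<close> add up to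
  a nonnegative number.\<close>

lemma
  fixes A :: "'a::real_vector \<Rightarrow> real set"
  assumes ne: "\<And>x. A x \<noteq> {}"
    and add: "\<And>x y a b. a \<in> A x \<Longrightarrow> b \<in> A y \<Longrightarrow> \<exists>c\<in>A (x + y). c \<le> a + b"
    and scale: "\<And>x a c. a \<in> A x \<Longrightarrow> 0 < c \<Longrightarrow> \<exists>b\<in>A (c *\<^sub>R x). b \<le> c * a"
    and zero: "\<And>a. a \<in> A 0 \<Longrightarrow> 0 \<le> a"
  shows bdd_below_sublinear_sets: "bdd_below (A x)"
    and sublinear_Inf: "sublinear (\<lambda>x. Inf (A x))"
proof -
  show bdd: "bdd_below (A x)" for x
  proof -
    obtain b where "b \<in> A (- x)"
      using ne by blast
    then have "- b \<le> a" if "a \<in> A x" for a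
      using add[OF that \<open>b \<in> A (- x)\<close>] zero by force
    then show ?thesis
      by (rule bdd_belowI)
  qed
  show "sublinear (\<lambda>x. Inf (A x))"
    unfolding sublinear_def
  proof (intro conjI allI impI)
    fix x y
    have "Inf (A (x + y)) - b \<le> Inf (A x)" if b: "b \<in> A y" for b
    proof (rule cInf_greatest[OF ne])
      fix a assume "a \<in> A x"
      with add[OF this b] show "Inf (A (x + y)) - b \<le> a"
        using cInf_lower[OF _ bdd] by (metis diff_le_eq order_trans)
    qed
    then have "Inf (A (x + y)) - Inf (A x) \<le> b" if "b \<in> A y" for b
      using that by force
    then have "Inf (A (x + y)) - Inf (A x) \<le> Inf (A y)"
      by (rule cInf_greatest[OF ne])
    then show "Inf (A (x + y)) \<le> Inf (A x) + Inf (A y)"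
      by simp
  next
    fix c :: real and x assume c: "0 < c"
    have "Inf (A (c *\<^sub>R x)) / c \<le> Inf (A x)"
    proof (rule cInf_greatest[OF ne])
      fix a assume "a \<in> A x"
      then obtain b where "b \<in> A (c *\<^sub>R x)" "b \<le> c * a"
        using scale c by blast
      with cInf_lower[OF this(1) bdd] c show "Inf (A (c *\<^sub>R x)) / c \<le> a"
        by (simp add: field_simps)
    qed
    with c show "Inf (A (c *\<^sub>R x)) \<le> c * Inf (A x)"
      by (simp add: field_simps)
  qed
qed

text \<open>For fixed \<open>a\<close>, the functional \<open>x \<mapsto> inf {q (x + t * a) - t * q a | t \<ge> 0}\<close> is sublinear and at
  most \<open>q\<close>, hence equal to \<open>q\<close>; then \<open>t = 1\<close> gives superadditivity.\<close>

lemma minimal_sublinear_linear: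
  fixes q :: "'a::real_vector \<Rightarrow> real"
  assumes q: "sublinear q"
    and min: "\<And>r. sublinear r \<Longrightarrow> r \<le> q \<Longrightarrow> r = q"
  shows "linear q"
proof -
  have add: "q (x + a) = q x + q a" for x a
  proof -
    define A where "A x = (\<lambda>t. q (x + t *\<^sub>R a) - t * q a) ` {0..}" for x
    have A_I: "q (x + t *\<^sub>R a) - t * q a \<in> A x" if "0 \<le> t" for x t
      using that by (auto simp: A_def)
    have A_add: "\<exists>c\<in>A (x + y). c \<le> b + b'" if b: "b \<in> A x" and b': "b' \<in> A y" for x y b b'
    proof -
      obtain s t where st: "0 \<le> s" "0 \<le> t"
        "b = q (x + s *\<^sub>R a) - s * q a" "b' = q (y + t *\<^sub>R a) - t * q a"
        using b b' by (auto simp: A_def)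
      have "q (x + y + (s + t) *\<^sub>R a) \<le> q (x + s *\<^sub>R a) + q (y + t *\<^sub>R a)"
        using sublinear_add[OF q, of "x + s *\<^sub>R a" "y + t *\<^sub>R a"] by (simp add: algebra_simps)
      with st show ?thesis
        by (intro bexI[OF _ A_I[of "s + t" "x + y"]]) (simp_all add: distrib_right)
    qed
    have A_scale: "\<exists>b'\<in>A (c *\<^sub>R x). b' \<le> c * b" if b: "b \<in> A x" and c: "0 < c" for x b c
    proof -
      obtain t where t: "0 \<le> t" "b = q (x + t *\<^sub>R a) - t * q a"
        using b by (auto simp: A_def)
      have "q (c *\<^sub>R x + (c * t) *\<^sub>R a) = c * q (x + t *\<^sub>R a)"
        using sublinear_scaleR[OF q, of c "x + t *\<^sub>R a"] c by (simp add: algebra_simps)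
      with t c show ?thesis
        by (intro bexI[OF _ A_I[of "c * t" "c *\<^sub>R x"]]) (simp_all add: right_diff_distrib)
    qed
    have A_zero: "0 \<le> b" if "b \<in> A 0" for b
      using that by (auto simp: A_def sublinear_scaleR[OF q])
    have A_ne: "A x \<noteq> {}" for x
      by (auto simp: A_def)
    note bdd = bdd_below_sublinear_sets[of A, OF A_ne A_add A_scale A_zero]
    have lower: "Inf (A x) \<le> q (x + t *\<^sub>R a) - t * q a" if "0 \<le> t" for x t
      using that by (intro cInf_lower bdd) (auto simp: A_def)
    have "(\<lambda>x. Inf (A x)) = q"
      using lower[of 0] sublinear_Inf[of A, OF A_ne A_add A_scale A_zero]
      by (intro min) (auto simp: le_fun_def)
    then have "q x \<le> q (x + a) - q a"
      using lower[of 1 x] by (auto dest: fun_cong[of _ _ x])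
    with sublinear_add[OF q, of x a] show ?thesis
      by simp
  qed
  have minus: "q (- x) = - q x" for x
    using add[of x "- x"] sublinear_zero[OF q] by simp
  have "q (c *\<^sub>R x) = c * q x" for c x
    using sublinear_scaleR[OF q, of c x] sublinear_scaleR[OF q, of "- c" x] minus[of "c *\<^sub>R x"]
    by (cases "0 \<le> c") auto
  with add show ?thesis
    by (intro linearI) auto
qed

text \<open>Zorn's lemma for the reversed order gives a minimal sublinear functional below
  \<open>p\<close>, and minimal ones are linear. A nonempty chain is bounded by its pointwise
  infimum.\<close>

theorem Hahn_Banach_sublinear:
  fixes p :: "'a::real_vector \<Rightarrow> real"
  assumes p: "sublinear p"
  obtains \<phi> where "linear \<phi>" "\<phi> \<le> p"
proof -
  define S where "S = {q. sublinear q \<and> q \<le> p}"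
  have "\<exists>m\<in>S. \<forall>q\<in>S. m \<ge> q \<longrightarrow> q = m"
  proof (rule predicate_Zorn)
    show "partial_order_on S (relation_of (\<ge>) S)"
      by (rule partial_order_on_relation_ofI) auto
  next
    fix C assume "C \<in> Chains (relation_of (\<ge>) S)"
    then have CS: "C \<subseteq> S" and chain: "q \<le> r \<or> r \<le> q" if "q \<in> C" "r \<in> C" for q r
      using that by (auto simp: Chains_def relation_of_def)
    then have C: "sublinear q" "q \<le> p" if "q \<in> C" for q
      using that by (auto simp: S_def)
    show "\<exists>u\<in>S. \<forall>q\<in>C. q \<ge> u"
    proof (cases "C = {}")
      case True
      with p show ?thesis
        by (auto simp: S_def)
    next
      case False
      define A where "A x = (\<lambda>q. q x) ` C" for x
      have A_add: "\<exists>c\<in>A (x + y). c \<le> a + b" if a: "a \<in> A x" and b: "b \<in> A y" for x y a b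
      proof -
        obtain q r where qr: "q \<in> C" "r \<in> C" "a = q x" "b = r y"
          using a b by (auto simp: A_def)
        \<comment> \<open>In a chain \<open>inf q r\<close> is \<open>q\<close> or \<open>r\<close>,
          so a single member of \<open>C\<close> serves both \<open>x\<close> and
          \<open>y\<close>.\<close>
        have "inf q r \<in> C"
          using chain[OF qr(1,2)] qr by (auto simp: inf_absorb1 inf_absorb2)
        moreover have "inf q r (x + y) \<le> inf q r x + inf q r y"
          using C(1)[OF calculation] by (rule sublinear_add)
        moreover have "inf q r x + inf q r y \<le> a + b"
          by (simp add: qr add_mono)
        ultimately show ?thesis
          by (intro bexI[of _ "inf q r (x + y)"]) (simp_all add: A_def del: inf_apply)
      qed
      have A_scale: "\<exists>b\<in>A (c *\<^sub>R x). b \<le> c * a" if "a \<in> A x" "0 < c" for x a c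
        using that by (auto simp: A_def sublinear_scaleR[OF C(1)])
      have A_zero: "0 \<le> a" if "a \<in> A 0" for a
        using that by (auto simp: A_def sublinear_zero[OF C(1)])
      have A_ne: "A x \<noteq> {}" for x
        using False by (auto simp: A_def)
      note bdd = bdd_below_sublinear_sets[of A, OF A_ne A_add A_scale A_zero]
      have lower: "(\<lambda>x. Inf (A x)) \<le> q" if "q \<in> C" for q
        using that by (auto simp: le_fun_def A_def intro!: cInf_lower bdd[unfolded A_def])
      moreover have "(\<lambda>x. Inf (A x)) \<in> S"
        using sublinear_Inf[of A, OF A_ne A_add A_scale A_zero] lower C(2) False
        by (auto simp: S_def intro: order_trans)
      ultimately show ?thesis
        by blast
    qed
  qed
  then obtain m where "m \<in> S" "\<And>q. q \<in> S \<Longrightarrow> q \<le> m \<Longrightarrow> q = m"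
    by blast
  then have "linear m" "m \<le> p"
    by (auto simp: S_def intro!: minimal_sublinear_linear intro: order_trans)
  then show ?thesis
    by (rule that)
qed

text \<open>Apply Hahn-Banach to \<open>x \<mapsto> inf {p (x + w) + q w - \<phi> w | w}\<close>; \<open>w = 0\<close> bounds \<open>\<phi>1\<close> by \<open>p\<close> and \<open>w = - x\<close>
  bounds \<open>\<phi> - \<phi>1\<close> by \<open>q\<close>.\<close>

lemma linear_split_sublinear_sum:
  fixes p q :: "'a::real_vector \<Rightarrow> real"
  assumes p: "sublinear p" and q: "sublinear q" and \<phi>: "linear \<phi>"
    and le: "\<And>x. \<phi> x \<le> p x + q x"
  obtains \<phi>1 \<phi>2 where "linear \<phi>1" "linear \<phi>2" "\<phi>1 \<le> p" "\<phi>2 \<le> q" "\<phi> = (\<lambda>x. \<phi>1 x + \<phi>2 x)"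
proof -
  define A where "A x = range (\<lambda>w. p (x + w) + q w - \<phi> w)" for x
  have A_I: "p (x + w) + q w - \<phi> w \<in> A x" for x w
    by (auto simp: A_def)
  have A_add: "\<exists>c\<in>A (x + y). c \<le> a + b" if a: "a \<in> A x" and b: "b \<in> A y" for x y a b
  proof -
    obtain v w where vw: "a = p (x + v) + q v - \<phi> v" "b = p (y + w) + q w - \<phi> w"
      using a b by (auto simp: A_def)
    have "p (x + y + (v + w)) \<le> p (x + v) + p (y + w)"
      using sublinear_add[OF p, of "x + v" "y + w"] by (simp add: algebra_simps)
    with vw sublinear_add[OF q, of v w] linear_add[OF \<phi>, of v w] show ?thesis
      by (intro bexI[OF _ A_I[of "x + y" "v + w"]]) auto
  qed
  have A_scale: "\<exists>b\<in>A (c *\<^sub>R x). b \<le> c * a" if a: "a \<in> A x" and c: "0 < c" for x a c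
  proof -
    obtain w where w: "a = p (x + w) + q w - \<phi> w"
      using a by (auto simp: A_def)
    have "p (c *\<^sub>R x + c *\<^sub>R w) = c * p (x + w)"
      using sublinear_scaleR[OF p, of c "x + w"] c by (simp add: scaleR_add_right)
    with w c sublinear_scaleR[OF q, of c w] linear_scale[OF \<phi>, of c w] show ?thesis
      by (intro bexI[OF _ A_I[of "c *\<^sub>R x" "c *\<^sub>R w"]]) (simp add: right_diff_distrib distrib_left)
  qed
  \<comment> \<open>At \<open>x = 0\<close> the elements are \<open>p w + q w - \<phi> w\<close>,
    nonnegative by the domination \<open>le\<close>.\<close>
  have A_zero: "0 \<le> a" if "a \<in> A 0" for a
    using that le by (force simp: A_def)
  have A_ne: "A x \<noteq> {}" for x
    by (auto simp: A_def)
  note bdd = bdd_below_sublinear_sets[of A, OF A_ne A_add A_scale A_zero]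
  obtain \<phi>1 where lin: "linear \<phi>1" and le1: "\<phi>1 \<le> (\<lambda>x. Inf (A x))"
    using Hahn_Banach_sublinear[OF sublinear_Inf[of A, OF A_ne A_add A_scale A_zero]] .
  have upper: "\<phi>1 x \<le> p (x + w) + q w - \<phi> w" for x w
    using le_funD[OF le1, of x] by (rule order_trans) (intro cInf_lower bdd A_I)
  show ?thesis
  proof
    show "linear \<phi>1" "linear (\<lambda>x. \<phi> x - \<phi>1 x)"
      using lin \<phi> by (auto intro: linear_compose_sub)
    show "\<phi>1 \<le> p"
      using upper[of _ 0] linear_0[OF \<phi>] sublinear_zero[OF q] by (auto simp: le_fun_def)
    show "(\<lambda>x. \<phi> x - \<phi>1 x) \<le> q"
      using upper[of "- x" x for x] linear_neg[OF lin] sublinear_zero[OF p]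
      by (auto simp: le_fun_def algebra_simps)
  qed simp
qed

section \<open>Topology\<close>

lemma tendsto_scaleR_lcs:
  fixes h :: "'b \<Rightarrow> 'a::locally_convex_space"
  assumes "(c \<longlongrightarrow> c0) F" "(h \<longlongrightarrow> x0) F"
  shows "((\<lambda>z. c z *\<^sub>R h z) \<longlongrightarrow> c0 *\<^sub>R x0) F"
  using filterlim_compose[OF tendsto_scaleR_Pair filterlim_Pair[OF assms]] by simp

text \<open>The bound \<open>C\<close> at \<open>c *\<^sub>R d\<close> and at
  \<open>(- c) *\<^sub>R d\<close> gives \<open>\<bar>\<phi> d\<bar> \<le> C / c\<close>. A large
  \<open>c\<close> yields continuity at 0, and linearity carries it to every point.\<close>

lemma linear_bounded_above_continuous:
  fixes \<phi> :: "'a::locally_convex_space \<Rightarrow> real"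
  assumes lin: "linear \<phi>" and ub: "\<forall>\<^sub>F d in nhds 0. \<phi> d \<le> C"
  shows "\<phi> \<in> dual_space"
proof -
  have small: "\<forall>\<^sub>F d in nhds 0. \<bar>\<phi> d\<bar> < \<epsilon>" if "0 < \<epsilon>" for \<epsilon>
  proof -
    define c where "c = (\<bar>C\<bar> + 1) / \<epsilon>"
    have c: "0 < c"
      using that by (simp add: c_def)
    have "((\<lambda>d. b *\<^sub>R d) \<longlongrightarrow> b *\<^sub>R 0) (nhds (0::'a))" for b
      by (intro tendsto_scaleR_lcs tendsto_const filterlim_ident)
    from this[of c] this[of "- c"] have "\<forall>\<^sub>F d in nhds 0. \<phi> (c *\<^sub>R d) \<le> C" "\<forall>\<^sub>F d in nhds 0. \<phi> ((- c) *\<^sub>R d) \<le> C"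
      using ub by (auto simp: filterlim_iff)
    then show ?thesis
    proof eventually_elim
      case (elim d)
      then have "c * \<bar>\<phi> d\<bar> \<le> C"
        using linear_scale[OF lin, of c d] linear_scale[OF lin, of "- c" d] by (auto simp: abs_if)
      also have "C < c * \<epsilon>"
        using that by (simp add: c_def)
      finally show ?case
        using c by simp
    qed
  qed
  have "(\<phi> \<longlongrightarrow> \<phi> x) (nhds x)" for x
  proof (rule tendstoI)
    fix \<epsilon> :: real assume "0 < \<epsilon>"
    have "((\<lambda>z. z - x) \<longlongrightarrow> x - x) (nhds x)"
      by (intro tendsto_diff tendsto_const filterlim_ident)
    then have "\<forall>\<^sub>F z in nhds x. \<bar>\<phi> (z - x)\<bar> < \<epsilon>"
      using small[OF \<open>0 < \<epsilon>\<close>] by (auto simp: filterlim_iff)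
    then show "\<forall>\<^sub>F z in nhds x. dist (\<phi> z) (\<phi> x) < \<epsilon>"
      by (simp add: dist_real_def linear_diff[OF lin])
  qed
  then have "continuous_on UNIV \<phi>"
    by (auto simp: continuous_on_def intro!: filterlim_mono[OF _ order_refl at_within_le_nhds])
  with lin show ?thesis
    by (simp add: dual_space_def)
qed


section \<open>The Clarke directional derivative\<close>

text \<open>Lipschitz continuity near \<open>y\<close> without reference to seminorms: increments from points close
  to \<open>y\<close> are bounded above along all directions in a neighbourhood of \<open>0\<close>.\<close>

definition lipschitz_near :: "('a::locally_convex_space \<Rightarrow> real) \<Rightarrow> 'a \<Rightarrow> bool" where
  "lipschitz_near F y \<longleftrightarrow>
     (\<exists>C. \<forall>\<^sub>F p in nhds y \<times>\<^sub>F nhds 0. \<forall>t\<in>{0<..1}. F (fst p + t *\<^sub>R snd p) - F (fst p) \<le> t * C)"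

text \<open>A number exceeding the limsup of the difference quotients as \<open>u \<longlongrightarrow> y\<close> and \<open>t \<down> 0\<close> is an eventual
  upper bound of them, so the limsup is the infimum of the eventual upper bounds.\<close>

definition clarke_bounds :: "('a::locally_convex_space \<Rightarrow> real) \<Rightarrow> 'a \<Rightarrow> 'a \<Rightarrow> real set" where
  "clarke_bounds F y d =
     {c. \<forall>\<^sub>F p in nhds y \<times>\<^sub>F at_right 0. F (fst p + snd p *\<^sub>R d) - F (fst p) \<le> snd p * c}"

definition clarke_derivative :: "('a::locally_convex_space \<Rightarrow> real) \<Rightarrow> 'a \<Rightarrow> 'a \<Rightarrow> real" where
  "clarke_derivative F y d = Inf (clarke_bounds F y d)"

lemma tendsto_scaleR_at_right_0:
  fixes h :: "'b \<Rightarrow> 'a::locally_convex_space"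
  assumes "filterlim c (at_right 0) F" "(h \<longlongrightarrow> l) F"
  shows "((\<lambda>z. c z *\<^sub>R h z) \<longlongrightarrow> 0) F"
  using tendsto_scaleR_lcs[of c 0 F h l] assms by (simp add: filterlim_at)

lemma eventually_at_right_0_less: "0 < s \<Longrightarrow> \<forall>\<^sub>F t in at_right 0. t < (s::real)"
  by (auto simp: eventually_at_right_field)

lemma eventually_at_right_0_pos: "\<forall>\<^sub>F t in at_right 0. 0 < (t::real)"
  by (rule eventually_at_right_less)

text \<open>Shrinking the increment by a factor \<open>s\<close> shrinks the Lipschitz bound by \<open>s\<close>.\<close>

lemma lipschitz_near_small:
  fixes F :: "'a::locally_convex_space \<Rightarrow> real"
  assumes "lipschitz_near F y" "0 < \<epsilon>"
  shows "\<forall>\<^sub>F p in nhds y \<times>\<^sub>F nhds 0. \<forall>t\<in>{0<..1}. F (fst p + t *\<^sub>R snd p) - F (fst p) \<le> t * \<epsilon>"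
proof -
  obtain C where C: "\<forall>\<^sub>F p in nhds y \<times>\<^sub>F nhds 0. \<forall>t\<in>{0<..1}.
      F (fst p + t *\<^sub>R snd p) - F (fst p) \<le> t * C"
    using assms by (auto simp: lipschitz_near_def)
  \<comment> \<open>The bound 1 keeps \<open>t * s\<close> in \<open>{0<..1}\<close>; the other one
    makes \<open>s * C \<le> \<epsilon>\<close>. The Lipschitz bound is then used with step
    \<open>t * s\<close> along \<open>(1 / s) *\<^sub>R d\<close>.\<close>
  define s where "s = min 1 (\<epsilon> / (\<bar>C\<bar> + 1))"
  have s: "0 < s" "s \<le> 1"
    using assms by (auto simp: s_def)
  have "s * C \<le> s * (\<bar>C\<bar> + 1)"
    using s by (intro mult_left_mono) auto
  also have "\<dots> \<le> \<epsilon> / (\<bar>C\<bar> + 1) * (\<bar>C\<bar> + 1)"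
    by (intro mult_right_mono) (auto simp: s_def)
  also have "\<dots> = \<epsilon>"
    by simp
  finally have sC: "s * C \<le> \<epsilon>" .
  have "((\<lambda>p. (1 / s) *\<^sub>R snd p) \<longlongrightarrow> (1 / s) *\<^sub>R 0) (nhds y \<times>\<^sub>F nhds (0::'a))"
    by (intro tendsto_scaleR_lcs tendsto_const filterlim_snd)
  then have "LIM p nhds y \<times>\<^sub>F nhds 0. (fst p, (1 / s) *\<^sub>R snd p) :> nhds y \<times>\<^sub>F nhds (0::'a)"
    by (intro filterlim_Pair filterlim_fst) simp
  from this[unfolded filterlim_iff, rule_format, OF C] show ?thesis
  proof eventually_elim
    case (elim p)
    show ?case
    proof
      fix t :: real assume t: "t \<in> {0<..1}"
      with s have "t * s \<in> {0<..1}"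
        by (auto simp: mult_le_one)
      with elim s have "F (fst p + t *\<^sub>R snd p) - F (fst p) \<le> (t * s) * C"
        by fastforce
      also have "\<dots> \<le> t * \<epsilon>"
        using sC t by simp
      finally show "F (fst p + t *\<^sub>R snd p) - F (fst p) \<le> t * \<epsilon>" .
    qed
  qed
qed

text \<open>Moving first along \<open>d'\<close> and then along \<open>d\<close> starts the second
  step at \<open>u + t *\<^sub>R d'\<close>, which still tends to \<open>y\<close>. This is why the
  base point varies in \<open>clarke_bounds\<close>.\<close>

lemma clarke_bounds_add:
  assumes "a \<in> clarke_bounds F y d" "b \<in> clarke_bounds F y d'"
  shows "a + b \<in> clarke_bounds F y (d + d')"
proof -
  have "((\<lambda>p. fst p + snd p *\<^sub>R d') \<longlongrightarrow> y + 0) (nhds y \<times>\<^sub>F at_right 0)"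
    by (intro tendsto_add filterlim_fst tendsto_scaleR_at_right_0[where l=d'] filterlim_snd tendsto_const)
  then have lim: "LIM p nhds y \<times>\<^sub>F at_right 0. (fst p + snd p *\<^sub>R d', snd p) :> nhds y \<times>\<^sub>F at_right 0"
    by (intro filterlim_Pair filterlim_snd) simp
  have "\<forall>\<^sub>F p in nhds y \<times>\<^sub>F at_right 0.
      F (fst p + snd p *\<^sub>R d' + snd p *\<^sub>R d) - F (fst p + snd p *\<^sub>R d') \<le> snd p * a"
    using eventually_compose_filterlim[OF assms(1)[unfolded clarke_bounds_def mem_Collect_eq] lim]
    by simp
  moreover have "\<forall>\<^sub>F p in nhds y \<times>\<^sub>F at_right 0. F (fst p + snd p *\<^sub>R d') - F (fst p) \<le> snd p * b"
    using assms(2) by (simp add: clarke_bounds_def)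
  ultimately have "\<forall>\<^sub>F p in nhds y \<times>\<^sub>F at_right 0.
      F (fst p + snd p *\<^sub>R (d + d')) - F (fst p) \<le> snd p * (a + b)"
  proof eventually_elim
    case (elim p)
    have "fst p + snd p *\<^sub>R d' + snd p *\<^sub>R d = fst p + snd p *\<^sub>R (d + d')"
      by (simp only: scaleR_add_right add_ac)
    with elim show ?case
      by (simp add: distrib_left)
  qed
  then show ?thesis
    by (simp add: clarke_bounds_def)
qed

lemma clarke_bounds_scaleR:
  assumes "a \<in> clarke_bounds F y d" "0 < c"
  shows "c * a \<in> clarke_bounds F y (c *\<^sub>R d)"
proof -
  have "LIM p nhds y \<times>\<^sub>F at_right 0. c * snd p :> at_right 0"
    using assms(2) filterlim_snd[of "at_right (0::real)" "nhds y"]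
    by (auto simp: filterlim_at intro: tendsto_mult_right_zero elim: eventually_mono)
  then have "LIM p nhds y \<times>\<^sub>F at_right 0. (fst p, c * snd p) :> nhds y \<times>\<^sub>F at_right 0"
    by (intro filterlim_Pair filterlim_fst)
  then have "\<forall>\<^sub>F p in nhds y \<times>\<^sub>F at_right 0.
      F (fst p + (c * snd p) *\<^sub>R d) - F (fst p) \<le> (c * snd p) * a"
    using assms(1) by (auto simp: clarke_bounds_def filterlim_iff)
  then show ?thesis
    by (simp add: clarke_bounds_def mult_ac)
qed

lemma clarke_bounds_at:
  assumes "c \<in> clarke_bounds F y d"
  shows "\<forall>\<^sub>F t in at_right 0. F (y + t *\<^sub>R d) - F y \<le> t * c"
proof -
  have "LIM t at_right 0. (y, t::real) :> nhds y \<times>\<^sub>F at_right 0"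
    by (intro filterlim_Pair tendsto_const filterlim_ident)
  with assms show ?thesis
    by (auto simp: clarke_bounds_def filterlim_iff)
qed

lemma clarke_bounds_zero:
  assumes "c \<in> clarke_bounds F y 0"
  shows "0 \<le> c"
proof -
  have "\<forall>\<^sub>F t in at_right (0::real). 0 \<le> c"
    using clarke_bounds_at[OF assms] eventually_at_right_0_pos
    by eventually_elim (simp add: zero_le_mult_iff)
  then show ?thesis
    by simp
qed

text \<open>One number serves all small directions; this makes the derivative finite and the linear
  functionals below it continuous.\<close>

lemma lipschitz_near_clarke_bounds:
  assumes "lipschitz_near F y"
  obtains C where "\<forall>\<^sub>F d in nhds 0. C \<in> clarke_bounds F y d"
proof -
  obtain C where "\<forall>\<^sub>F p in nhds y \<times>\<^sub>F nhds 0. \<forall>t\<in>{0<..1}.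
      F (fst p + t *\<^sub>R snd p) - F (fst p) \<le> t * C"
    using assms by (auto simp: lipschitz_near_def)
  then obtain P Q where P: "eventually P (nhds y)" and Q: "eventually Q (nhds 0)"
    and PQ: "\<And>v d t. P v \<Longrightarrow> Q d \<Longrightarrow> t \<in> {0<..1} \<Longrightarrow> F (v + t *\<^sub>R d) - F v \<le> t * C"
    by (auto simp: eventually_prod_filter)
  have "C \<in> clarke_bounds F y d" if "Q d" for d
  proof -
    have "\<forall>\<^sub>F t in at_right 0. t \<in> {0<..1::real}"
      by (auto simp: eventually_at_right_field intro!: exI[of _ 1])
    from eventually_prodI[OF P this] show ?thesis
      unfolding clarke_bounds_def mem_Collect_eq
      by eventually_elim (use PQ that in auto)
  qed
  with Q show ?thesis
    by (intro that[of C]) (auto elim: eventually_mono)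
qed

text \<open>Small positive multiples of \<open>d\<close> share the common bound, and scaling by
  \<open>1 / t\<close> returns to \<open>d\<close>.\<close>

lemma clarke_bounds_nonempty:
  assumes "lipschitz_near F y"
  shows "clarke_bounds F y d \<noteq> {}"
proof -
  obtain C where C: "\<forall>\<^sub>F d in nhds 0. C \<in> clarke_bounds F y d"
    using lipschitz_near_clarke_bounds[OF assms] .
  have "((\<lambda>t. t *\<^sub>R d) \<longlongrightarrow> 0) (at_right 0)"
    by (intro tendsto_scaleR_at_right_0[where l=d] filterlim_ident tendsto_const)
  with C have "\<forall>\<^sub>F t in at_right 0. C \<in> clarke_bounds F y (t *\<^sub>R d)"
    by (auto simp: filterlim_iff)
  with eventually_at_right_0_pos
  have "\<forall>\<^sub>F t in at_right (0::real). 0 < t \<and> C \<in> clarke_bounds F y (t *\<^sub>R d)"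
    by (rule eventually_conj)
  then obtain t :: real where "0 < t" "C \<in> clarke_bounds F y (t *\<^sub>R d)"
    by (auto dest: eventually_happens)
  then have "1 / t * C \<in> clarke_bounds F y d"
    using clarke_bounds_scaleR[of C F y "t *\<^sub>R d" "1 / t"] by simp
  then show ?thesis
    by blast
qed

lemma
  assumes "lipschitz_near F y"
  shows clarke_derivative_lower: "c \<in> clarke_bounds F y d \<Longrightarrow> clarke_derivative F y d \<le> c"
    and clarke_derivative_sublinear: "sublinear (clarke_derivative F y)"
proof -
  \<comment> \<open>These are the hypotheses of the infimum lemmas; sums and multiples of bounds are
    bounds themselves, hence \<open>order_refl\<close>.\<close>
  note rules = clarke_bounds_nonempty[OF assms] bexI[OF order_refl clarke_bounds_add]
    bexI[OF order_refl clarke_bounds_scaleR] clarke_bounds_zero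
  show "clarke_derivative F y d \<le> c" if "c \<in> clarke_bounds F y d"
    unfolding clarke_derivative_def
    using that by (intro cInf_lower bdd_below_sublinear_sets[of "clarke_bounds F y"] rules)
  show "sublinear (clarke_derivative F y)"
    unfolding clarke_derivative_def
    by (intro sublinear_Inf[of "clarke_bounds F y"] rules)
qed

text \<open>On the ray from \<open>y\<close> along \<open>d\<close>, minimality bounds
  \<open>t * \<phi> d\<close> by the sum of both increments, hence by \<open>t * (a + b)\<close>.
  Divide by \<open>t\<close>, then take infima over \<open>a\<close> and \<open>b\<close> in
  turn.\<close>

lemma local_minimum_clarke_derivative:
  assumes F: "lipschitz_near F y" and G: "lipschitz_near G y" and \<phi>: "linear \<phi>"
    and min: "\<forall>\<^sub>F x in nhds y. F y + G y - \<phi> y \<le> F x + G x - \<phi> x"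
  shows "\<phi> d \<le> clarke_derivative F y d + clarke_derivative G y d"
proof -
  have le: "\<phi> d \<le> a + b" if a: "a \<in> clarke_bounds F y d" and b: "b \<in> clarke_bounds G y d" for a b
  proof -
    have "((\<lambda>t. y + t *\<^sub>R d) \<longlongrightarrow> y + 0) (at_right 0)"
      by (intro tendsto_add tendsto_scaleR_at_right_0[where l=d] filterlim_ident tendsto_const)
    with min have "\<forall>\<^sub>F t in at_right 0.
        F y + G y - \<phi> y \<le> F (y + t *\<^sub>R d) + G (y + t *\<^sub>R d) - \<phi> (y + t *\<^sub>R d)"
      by (auto simp: filterlim_iff)
    with clarke_bounds_at[OF a] clarke_bounds_at[OF b] eventually_at_right_0_pos
    have "\<forall>\<^sub>F t::real in at_right 0. \<phi> d \<le> a + b"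
    proof eventually_elim
      case (elim t)
      then have "t * \<phi> d \<le> t * (a + b)"
        by (simp add: linear_add[OF \<phi>] linear_scale[OF \<phi>] algebra_simps)
      with elim show ?case
        by simp
    qed
    then show ?thesis
      by simp
  qed
  have "\<phi> d - b \<le> clarke_derivative F y d" if "b \<in> clarke_bounds G y d" for b
    unfolding clarke_derivative_def
    using le[OF _ that] by (intro cInf_greatest clarke_bounds_nonempty F) force
  then have "\<phi> d - clarke_derivative F y d \<le> b" if "b \<in> clarke_bounds G y d" for b
    using that by force
  then have "\<phi> d - clarke_derivative F y d \<le> clarke_derivative G y d"
    unfolding clarke_derivative_def[of G] by (intro cInf_greatest clarke_bounds_nonempty G)
  then show ?thesis
    by simp
qed

lemma linear_le_clarke_derivative_in_dual:
  assumes F: "lipschitz_near F y" and "linear \<phi>" "\<phi> \<le> clarke_derivative F y"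
  shows "\<phi> \<in> dual_space"
proof -
  obtain C where "\<forall>\<^sub>F d in nhds 0. C \<in> clarke_bounds F y d"
    using lipschitz_near_clarke_bounds[OF F] .
  then have "\<forall>\<^sub>F d in nhds 0. \<phi> d \<le> C"
    by eventually_elim (use assms in \<open>auto simp: le_fun_def intro: order_trans clarke_derivative_lower\<close>)
  with assms(2) show ?thesis
    by (rule linear_bounded_above_continuous)
qed

section \<open>\<open>e\<close>-convex functions\<close>

text \<open>On \<open>edom f\<close> the values of \<open>f\<close> and \<open>e\<close> are finite,
  so the inequality can be used in real arithmetic.\<close>

lemma e_convex_real:
  assumes cv: "e_convex e f" and f: "\<forall>x. f x \<noteq> -\<infinity>" and e: "error_function e"
    and x: "x \<in> edom f" and y: "y \<in> edom f" and t: "0 < t" "t < 1"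
  shows "t *\<^sub>R x + (1 - t) *\<^sub>R y \<in> edom f"
    and "real_of_ereal (f (t *\<^sub>R x + (1 - t) *\<^sub>R y)) \<le>
      t * real_of_ereal (f x) + (1 - t) * real_of_ereal (f y) + t * (1 - t) * real_of_ereal (e (x, y))"
proof -
  have "(x, y) \<in> edom e" "0 \<le> e (x, y)"
    using cv e x y by (auto simp: e_convex_def error_function_def)
  then obtain c where c: "e (x, y) = ereal c"
    by (cases "e (x, y)") (auto simp: edom_def)
  obtain a b where ab: "f x = ereal a" "f y = ereal b"
    using x y f by (cases "f x"; cases "f y") (auto simp: edom_def)
  have "f (t *\<^sub>R x + (1 - t) *\<^sub>R y) \<le> ereal (t * a + (1 - t) * b + t * (1 - t) * c)"
    using cv t ab c unfolding e_convex_def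
    by (metis greaterThanLessThan_iff plus_ereal.simps(1) times_ereal.simps(1))
  with ab c f[rule_format, of "t *\<^sub>R x + (1 - t) *\<^sub>R y"]
  show "t *\<^sub>R x + (1 - t) *\<^sub>R y \<in> edom f"
    "real_of_ereal (f (t *\<^sub>R x + (1 - t) *\<^sub>R y)) \<le>
      t * real_of_ereal (f x) + (1 - t) * real_of_ereal (f y) + t * (1 - t) * real_of_ereal (e (x, y))"
    by (cases "f (t *\<^sub>R x + (1 - t) *\<^sub>R y)"; simp add: edom_def)+
qed

context
  fixes e :: "'a::locally_convex_space \<times> 'a \<Rightarrow> ereal" and f :: "'a \<Rightarrow> ereal"
  assumes e: "error_function e" and f: "\<forall>x. f x \<noteq> -\<infinity>" and cv: "e_convex e f"
begin

text \<open>\<open>real_of_ereal\<close> sends both infinities to 0, so \<open>F\<close> and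
  \<open>E\<close> represent \<open>f\<close> and \<open>e\<close> only where these are
  finite.\<close>

abbreviation (input) "F \<equiv> \<lambda>x. real_of_ereal (f x)"
abbreviation (input) "E \<equiv> \<lambda>p. real_of_ereal (e p)"

lemma real_error_nonneg: "0 \<le> E (x, y)"
  using e by (auto simp: error_function_def intro: real_of_ereal_pos)

lemma ereal_real_on_edom: "x \<in> edom f \<Longrightarrow> f x = ereal (F x)"
  using f by (cases "f x") (auto simp: edom_def)

lemma ereal_real_error: "x \<in> edom f \<Longrightarrow> y \<in> edom f \<Longrightarrow> e (x, y) = ereal (E (x, y))"
  using e cv by (cases "e (x, y)") (auto simp: edom_def e_convex_def error_function_def)

text \<open>Near \<open>y\<close> there are bounds \<open>F x \<le> M\<close> and
  \<open>E p \<le> K\<close>. Reflection in \<open>y\<close> turns the first into a lower bound, and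
  convexity between \<open>u\<close> and \<open>u + d\<close> then bounds the increments.\<close>

lemma e_convex_lipschitz_near:
  assumes y: "y \<in> interior (edom f)"
    and fb: "locally_bounded_above_on (interior (edom f)) f"
    and eb: "locally_bounded_on (edom f \<times> edom f) e"
  shows "lipschitz_near F y"
proof -
  have dom: "\<forall>\<^sub>F x in nhds y. x \<in> interior (edom f)"
    using y by (intro eventually_nhds_in_open) auto
  obtain U M where "open U" "y \<in> U" and M: "\<forall>z\<in>U \<inter> interior (edom f). f z \<le> ereal M"
    using fb y unfolding locally_bounded_above_on_def by blast
  then have "\<forall>\<^sub>F x in nhds y. x \<in> U"
    by (intro eventually_nhds_in_open)
  with dom have F_ub: "\<forall>\<^sub>F x in nhds y. x \<in> edom f \<and> F x \<le> M"
  proof eventually_elim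
    case (elim x)
    with M interior_subset[of "edom f"] have "x \<in> edom f" "f x \<le> ereal M"
      by auto
    then show ?case
      by (cases "f x") (auto simp: edom_def f)
  qed
  have "y \<in> edom f"
    using y interior_subset by blast
  obtain V K where "open V" "(y, y) \<in> V" and K: "\<forall>z\<in>V \<inter> edom f \<times> edom f. \<bar>e z\<bar> \<le> ereal K"
    using eb \<open>y \<in> edom f\<close> unfolding locally_bounded_on_def by blast
  then have "\<forall>\<^sub>F p in nhds y \<times>\<^sub>F nhds y. p \<in> V"
    by (auto simp: nhds_prod[symmetric] intro: eventually_nhds_in_open)
  moreover have "\<forall>\<^sub>F p in nhds y \<times>\<^sub>F nhds y. fst p \<in> edom f \<and> snd p \<in> edom f"
    using eventually_prodI[OF F_ub F_ub] by (auto elim: eventually_mono)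
  ultimately have E_ub: "\<forall>\<^sub>F p in nhds y \<times>\<^sub>F nhds y. E p \<le> K"
  proof eventually_elim
    case (elim p)
    then have "p \<in> edom f \<times> edom f" "\<bar>e p\<bar> \<le> ereal K"
      using K by (auto simp: mem_Times_iff)
    then show ?case
      by (cases "e p") auto
  qed
  have refl: "((\<lambda>u. y + y - u) \<longlongrightarrow> y + y - y) (nhds y)"
    by (intro tendsto_diff tendsto_const filterlim_ident)
  then have refl: "((\<lambda>u. y + y - u) \<longlongrightarrow> y) (nhds y)"
    by simp
  have "LIM u nhds y. (u, y + y - u) :> nhds y \<times>\<^sub>F nhds y"
    by (intro filterlim_Pair filterlim_ident refl)
  then have "\<forall>\<^sub>F u in nhds y. E (u, y + y - u) \<le> K"
    using E_ub by (auto simp: filterlim_iff)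
  moreover have "\<forall>\<^sub>F u in nhds y. y + y - u \<in> edom f \<and> F (y + y - u) \<le> M"
    using refl F_ub by (auto simp: filterlim_iff)
  \<comment> \<open>As \<open>y\<close> is the midpoint of \<open>u\<close> and
    \<open>y + y - u\<close>, convexity gives
    \<open>F y \<le> F u / 2 + M / 2 + K / 4\<close>.\<close>
  ultimately have F_lb: "\<forall>\<^sub>F u in nhds y. 2 * F y - M - K / 2 \<le> F u"
    using F_ub
  proof eventually_elim
    case (elim u)
    have "(1/2) *\<^sub>R u + (1 - 1/2) *\<^sub>R (y + y - u) = y"
      by (simp add: algebra_simps flip: scaleR_add_left)
    with e_convex_real(2)[OF cv f e, of u "y + y - u" "1/2"] elim
    have "F y \<le> 1/2 * F u + 1/2 * F (y + y - u) + 1/4 * E (u, y + y - u)"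
      by simp
    with elim show ?case
      by linarith
  qed
  \<comment> \<open>Upper bound minus lower bound of \<open>F\<close>, plus the bound of the error
    term.\<close>
  define C where "C = M - (2 * F y - M - K / 2) + K"
  have sum: "((\<lambda>p. fst p + snd p) \<longlongrightarrow> y + 0) (nhds y \<times>\<^sub>F nhds 0)"
    by (intro tendsto_add filterlim_fst filterlim_snd)
  then have "LIM p nhds y \<times>\<^sub>F nhds 0. (fst p + snd p, fst p) :> nhds y \<times>\<^sub>F nhds y"
    by (intro filterlim_Pair filterlim_fst) simp
  then have "\<forall>\<^sub>F p in nhds y \<times>\<^sub>F nhds 0. E (fst p + snd p, fst p) \<le> K"
    using E_ub by (auto simp: filterlim_iff)
  moreover have "\<forall>\<^sub>F p in nhds y \<times>\<^sub>F nhds 0. fst p + snd p \<in> edom f \<and> F (fst p + snd p) \<le> M"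
    using sum F_ub by (auto simp: filterlim_iff)
  moreover have "\<forall>\<^sub>F p in nhds y \<times>\<^sub>F nhds (0::'a). 2 * F y - M - K / 2 \<le> F (fst p)"
    using filterlim_fst[of "nhds y" "nhds (0::'a)"] F_lb by (auto simp: filterlim_iff)
  moreover have "\<forall>\<^sub>F p in nhds y \<times>\<^sub>F nhds (0::'a). fst p \<in> edom f"
    using filterlim_fst[of "nhds y" "nhds (0::'a)"] F_ub
    by (auto simp: filterlim_iff elim: eventually_mono)
  ultimately have "\<forall>\<^sub>F p in nhds y \<times>\<^sub>F nhds 0. \<forall>t\<in>{0<..1}.
      F (fst p + t *\<^sub>R snd p) - F (fst p) \<le> t * C"
  proof eventually_elim
    case (elim p)
    show ?case
    proof
      fix t :: real assume t: "t \<in> {0<..1}"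
      have C: "F (fst p + snd p) - F (fst p) + E (fst p + snd p, fst p) \<le> C"
        using elim by (simp add: C_def)
      \<comment> \<open>Convexity is assumed only for \<open>t < 1\<close>, so the endpoint is
        treated directly.\<close>
      show "F (fst p + t *\<^sub>R snd p) - F (fst p) \<le> t * C"
      proof (cases "t = 1")
        case True
        with C real_error_nonneg[of "fst p + snd p" "fst p"] show ?thesis
          by simp
      next
        case False
        have "t *\<^sub>R (fst p + snd p) + (1 - t) *\<^sub>R fst p = fst p + t *\<^sub>R snd p"
          by (simp add: algebra_simps)
        then have "F (fst p + t *\<^sub>R snd p) - F (fst p) \<le>
            t * (F (fst p + snd p) - F (fst p) + (1 - t) * E (fst p + snd p, fst p))"
          using e_convex_real(2)[OF cv f e, of "fst p + snd p" "fst p" t] elim t False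
          by (simp add: algebra_simps)
        also have "\<dots> \<le> t * C"
          using C t real_error_nonneg[of "fst p + snd p" "fst p"]
            mult_right_mono[of "1 - t" 1 "E (fst p + snd p, fst p)"]
          by (intro mult_left_mono) auto
        finally show ?thesis .
      qed
    qed
  qed
  then show ?thesis
    by (auto simp: lipschitz_near_def)
qed

text \<open>Convexity controls the increment of \<open>f\<close> from \<open>u\<close> towards \<open>x\<close>; the direction \<open>x - u\<close> is exchanged
  for \<open>x - y\<close> at a Lipschitz cost \<open>t * \<epsilon>\<close>, because \<open>u - y\<close> tends to \<open>0\<close>.\<close>

lemma e_convex_clarke_derivative_le:
  assumes lip: "lipschitz_near F y" and y: "y \<in> interior (edom f)" and x: "x \<in> edom f"
    and usc: "usc_on (edom f) (\<lambda>u. e (u, x))"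
  shows "clarke_derivative F y (x - y) \<le> F x - F y + E (x, y)"
proof (rule field_le_epsilon)
  fix \<epsilon>' :: real assume "0 < \<epsilon>'"
  \<comment> \<open>Three losses of \<open>\<epsilon>\<close> occur: semicontinuity of
    \<open>e\<close>, the lower estimate of \<open>F u\<close>, and the change of direction.\<close>
  define \<epsilon> where "\<epsilon> = \<epsilon>' / 3"
  with \<open>0 < \<epsilon>'\<close> have \<epsilon>: "0 < \<epsilon>"
    by simp
  have dom: "\<forall>\<^sub>F u in nhds y. u \<in> edom f"
    using y interior_subset[of "edom f"]
    by (intro eventually_mono[OF eventually_nhds_in_open[of "interior (edom f)"]]) auto
  have y_dom: "y \<in> edom f"
    using y interior_subset by blast
  have sym: "E (x, u) = E (u, x)" for u
    using e by (simp add: error_function_def)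
  have "e (y, x) < ereal (E (y, x) + \<epsilon>)"
    using \<epsilon> by (subst ereal_real_error[OF y_dom x]) simp
  moreover from this have "\<forall>\<^sub>F u in at y. e (u, x) < ereal (E (y, x) + \<epsilon>)"
    using usc y_dom unfolding usc_on_def at_within_interior[OF y, symmetric] by blast
  ultimately have "\<forall>\<^sub>F u in nhds y. e (u, x) < ereal (E (y, x) + \<epsilon>)"
    by (simp add: eventually_nhds_conv_at)
  with dom have E_usc: "\<forall>\<^sub>F u in nhds y. E (x, u) \<le> E (x, y) + \<epsilon>"
  proof eventually_elim
    case (elim u)
    then have "ereal (E (u, x)) < ereal (E (y, x) + \<epsilon>)"
      by (simp only: ereal_real_error[OF _ x, symmetric])
    then show ?case
      by (simp add: sym)
  qed
  have "((\<lambda>u. y - u) \<longlongrightarrow> y - y) (nhds y)"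
    by (intro tendsto_diff tendsto_const filterlim_ident)
  then have "LIM u nhds y. (u, y - u) :> nhds y \<times>\<^sub>F nhds 0"
    by (intro filterlim_Pair filterlim_ident) simp
  then have "\<forall>\<^sub>F u in nhds y. \<forall>t\<in>{0<..1}. F (u + t *\<^sub>R (y - u)) - F u \<le> t * \<epsilon>"
    using lipschitz_near_small[OF lip \<epsilon>] by (auto simp: filterlim_iff)
  \<comment> \<open>With \<open>t = 1\<close> the increment from \<open>u\<close> along
    \<open>y - u\<close> ends at \<open>y\<close>.\<close>
  then have F_lsc: "\<forall>\<^sub>F u in nhds y. F y - F u \<le> \<epsilon>"
    by eventually_elim (auto dest: bspec[of _ _ 1])
  let ?N = "nhds y \<times>\<^sub>F at_right (0::real)"
  have "((\<lambda>p. fst p - y) \<longlongrightarrow> y - y) ?N"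
    by (intro tendsto_diff tendsto_const filterlim_fst)
  moreover have "((\<lambda>p. fst p + snd p *\<^sub>R (x - fst p)) \<longlongrightarrow> y + 0) ?N"
    by (intro tendsto_add tendsto_scaleR_at_right_0[where l="x - y"] tendsto_diff tendsto_const filterlim_fst
        filterlim_snd)
  ultimately have "LIM p ?N. (fst p + snd p *\<^sub>R (x - fst p), fst p - y) :> nhds y \<times>\<^sub>F nhds 0"
    by (intro filterlim_Pair) simp_all
  \<comment> \<open>Since \<open>x - y = (x - u) + (u - y)\<close>, the change of direction is an
    increment along \<open>u - y\<close> from the point reached towards \<open>x\<close>.\<close>
  then have "\<forall>\<^sub>F p in ?N. \<forall>t\<in>{0<..1}.
      F (fst p + snd p *\<^sub>R (x - fst p) + t *\<^sub>R (fst p - y)) - F (fst p + snd p *\<^sub>R (x - fst p)) \<le> t * \<epsilon>"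
    using lipschitz_near_small[OF lip \<epsilon>] by (auto simp: filterlim_iff)
  moreover have "\<forall>\<^sub>F p in ?N. fst p \<in> edom f" "\<forall>\<^sub>F p in ?N. F y - F (fst p) \<le> \<epsilon>"
      "\<forall>\<^sub>F p in ?N. E (x, fst p) \<le> E (x, y) + \<epsilon>"
    using filterlim_fst[of "nhds y" "at_right (0::real)"] dom F_lsc E_usc by (auto simp: filterlim_iff)
  moreover have "\<forall>\<^sub>F p in ?N. 0 < snd p" "\<forall>\<^sub>F p in ?N. snd p < 1"
    using filterlim_snd[of "at_right (0::real)" "nhds y"]
      eventually_at_right_0_pos eventually_at_right_0_less[of 1] by (auto simp: filterlim_iff)
  ultimately have "\<forall>\<^sub>F p in ?N. F (fst p + snd p *\<^sub>R (x - y)) - F (fst p) \<le>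
      snd p * (F x - F y + E (x, y) + \<epsilon>')"
  proof eventually_elim
    case (elim p)
    obtain u t where p: "p = (u, t)"
      by (cases p)
    have shift: "u + t *\<^sub>R (x - y) = u + t *\<^sub>R (x - u) + t *\<^sub>R (u - y)"
      by (simp add: algebra_simps)
    have "F (u + t *\<^sub>R (x - y)) - F (u + t *\<^sub>R (x - u)) \<le> t * \<epsilon>"
      unfolding shift using elim p by simp
    moreover have "t *\<^sub>R x + (1 - t) *\<^sub>R u = u + t *\<^sub>R (x - u)"
      by (simp add: algebra_simps)
    then have "F (u + t *\<^sub>R (x - u)) - F u \<le> t * (F x - F u + (1 - t) * E (x, u))"
      using e_convex_real(2)[OF cv f e, of x u t] elim p x by (simp add: algebra_simps)
    moreover have "t * (F x - F u + (1 - t) * E (x, u)) \<le> t * (F x - (F y - \<epsilon>) + (E (x, y) + \<epsilon>))"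
      using elim p real_error_nonneg[of x u] mult_right_mono[of "1 - t" 1 "E (x, u)"]
      by (intro mult_left_mono) auto
    ultimately show ?case
      by (simp add: p \<epsilon>_def algebra_simps)
  qed
  then have "F x - F y + E (x, y) + \<epsilon>' \<in> clarke_bounds F y (x - y)"
    by (simp add: clarke_bounds_def)
  then show "clarke_derivative F y (x - y) \<le> F x - F y + E (x, y) + \<epsilon>'"
    by (rule clarke_derivative_lower[OF lip])
qed

text \<open>On \<open>edom f\<close>, \<open>\<phi> x - \<phi> y\<close> is at most the derivative
  along \<open>x - y\<close>, hence at most \<open>F x - F y + E (x, y)\<close>. Elsewhere the term
  of the supremum is \<open>-\<infinity>\<close>.\<close>

lemma e_conjugate_le_of_le_clarke_derivative:
  assumes lip: "lipschitz_near F y" and y: "y \<in> interior (edom f)"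
    and usc: "\<forall>x\<in>edom f. usc_on (edom f) (\<lambda>u. e (u, x))"
    and \<phi>: "linear \<phi>" "\<phi> \<le> clarke_derivative F y"
  shows "e_conjugate e y f \<phi> \<le> ereal (\<phi> y - F y)"
  unfolding e_conjugate_def
proof (rule SUP_least)
  fix x
  show "ereal (\<phi> x) - f x - e (x, y) \<le> ereal (\<phi> y - F y)"
  proof (cases "x \<in> edom f")
    case True
    have "y \<in> edom f"
      using y interior_subset by blast
    then obtain a c where "f x = ereal a" "e (x, y) = ereal c"
      using ereal_real_on_edom[OF True] ereal_real_error[OF True] by blast
    moreover have "\<phi> x - \<phi> y \<le> F x - F y + E (x, y)"
      using le_funD[OF \<phi>(2), of "x - y"] e_convex_clarke_derivative_le[OF lip y True] usc True
      by (simp add: linear_diff[OF \<phi>(1)])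
    ultimately show ?thesis
      by simp
  next
    case False
    \<comment> \<open>This excludes \<open>e (x, y) = -\<infinity>\<close>, where
      \<open>-\<infinity> - e (x, y)\<close> would be \<open>\<infinity>\<close>.\<close>
    moreover have "0 \<le> e (x, y)"
      using e by (simp add: error_function_def)
    ultimately show ?thesis
      by (cases "e (x, y)") (auto simp: edom_def)
  qed
qed

end


section \<open>Conjugates of sums and infimal convolution\<close>

text \<open>For each splitting of \<open>\<phi>\<close>, the term at \<open>x\<close> is the sum of
  the terms of both conjugates, or \<open>-\<infinity>\<close> if one of the four values is
  infinite.\<close>

lemma e_conjugate_add_le_inf_convolution:
  assumes e: "error_function e" and e': "error_function e'"
    and f: "\<forall>x. f x \<noteq> -\<infinity>" and g: "\<forall>x. g x \<noteq> -\<infinity>"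
  shows "e_conjugate (\<lambda>p. e p + e' p) y (\<lambda>x. f x + g x) \<phi> \<le>
    inf_convolution (e_conjugate e y f) (e_conjugate e' y g) \<phi>"
  unfolding inf_convolution_def
proof (rule Inf_greatest, clarify)
  fix \<phi>1 \<phi>2 :: "'a \<Rightarrow> real"
  show "e_conjugate (\<lambda>p. e p + e' p) y (\<lambda>x. f x + g x) (\<lambda>x. \<phi>1 x + \<phi>2 x) \<le>
    lower_add (e_conjugate e y f \<phi>1) (e_conjugate e' y g \<phi>2)"
    unfolding e_conjugate_def[of "\<lambda>p. e p + e' p"]
  proof (rule SUP_least)
    fix x
    have nonneg: "0 \<le> e (x, y)" "0 \<le> e' (x, y)"
      using e e' by (simp_all add: error_function_def)
    have le1: "ereal (\<phi>1 x) - f x - e (x, y) \<le> e_conjugate e y f \<phi>1"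
      and le2: "ereal (\<phi>2 x) - g x - e' (x, y) \<le> e_conjugate e' y g \<phi>2"
      unfolding e_conjugate_def by (auto intro: SUP_upper)
    show "ereal (\<phi>1 x + \<phi>2 x) - (f x + g x) - (e (x, y) + e' (x, y)) \<le>
      lower_add (e_conjugate e y f \<phi>1) (e_conjugate e' y g \<phi>2)"
    proof (cases "f x = \<infinity> \<or> g x = \<infinity> \<or> e (x, y) = \<infinity> \<or> e' (x, y) = \<infinity>")
      case True
      then have "ereal (\<phi>1 x + \<phi>2 x) - (f x + g x) - (e (x, y) + e' (x, y)) = -\<infinity>"
        using f[rule_format, of x] g[rule_format, of x] nonneg
        by (cases "f x"; cases "g x"; cases "e (x, y)"; cases "e' (x, y)") auto
      then show ?thesis
        by simp
    next
      \<comment> \<open>Finite values keep both conjugates above \<open>-\<infinity>\<close>, so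
        \<open>lower_add\<close> is ordinary addition here.\<close>
      case False
      then obtain a b c d where "f x = ereal a" "g x = ereal b" "e (x, y) = ereal c" "e' (x, y) = ereal d"
        using f[rule_format, of x] g[rule_format, of x] nonneg
        by (cases "f x"; cases "g x"; cases "e (x, y)"; cases "e' (x, y)") auto
      with add_mono[OF le1 le2] le1 le2 show ?thesis
        by (auto simp: lower_add_def algebra_simps)
    qed
  qed
qed

theorem theorem22:
  fixes e e' :: "'a::locally_convex_space \<times> 'a \<Rightarrow> ereal"
    and f g :: "'a \<Rightarrow> ereal"
  assumes "error_function e" and "error_function e'"
    and "\<forall>x. f x \<noteq> -\<infinity>" and "\<forall>x. g x \<noteq> -\<infinity>"
    and "e_convex e f" and "\<forall>x\<in>edom f. e (x, x) = 0"
    and "e_convex e' g" and "\<forall>z\<in>edom g. e' (z, z) = 0"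
    and "locally_bounded_above_on (interior (edom f)) f"
    and "locally_bounded_above_on (interior (edom g)) g"
    and "\<forall>x\<in>edom f. usc_on (edom f) (\<lambda>u. e (u, x))"
    and "\<forall>z\<in>edom g. usc_on (edom g) (\<lambda>u. e' (u, z))"
  shows "(\<forall>y. \<forall>\<phi>\<in>dual_space.
            e_conjugate (\<lambda>p. e p + e' p) y (\<lambda>x. f x + g x) \<phi>
              \<le> inf_convolution (e_conjugate e y f) (e_conjugate e' y g) \<phi>) \<and>
         (locally_bounded_on (edom f \<times> edom f) e \<longrightarrow>
          locally_bounded_on (edom g \<times> edom g) e' \<longrightarrow>
          (\<forall>y \<in> interior (edom f) \<inter> interior (edom g). \<forall>\<phi>\<in>dual_space.
            local_minimum_point (\<lambda>x. f x + g x - ereal (\<phi> x)) y \<longrightarrow>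
            e_conjugate (\<lambda>p. e p + e' p) y (\<lambda>x. f x + g x) \<phi>
              = inf_convolution (e_conjugate e y f) (e_conjugate e' y g) \<phi>))"
proof (intro conjI impI allI ballI)
  fix y and \<phi> :: "'a \<Rightarrow> real"
  \<comment> \<open>This closes (i) and later supplies one half of the equality in (ii).\<close>
  show le: "e_conjugate (\<lambda>p. e p + e' p) y (\<lambda>x. f x + g x) \<phi>
    \<le> inf_convolution (e_conjugate e y f) (e_conjugate e' y g) \<phi>"
    by (intro e_conjugate_add_le_inf_convolution assms)
  assume eb: "locally_bounded_on (edom f \<times> edom f) e" and eb': "locally_bounded_on (edom g \<times> edom g) e'"
    and y: "y \<in> interior (edom f) \<inter> interior (edom g)" and \<phi>: "\<phi> \<in> dual_space"
    and min: "local_minimum_point (\<lambda>x. f x + g x - ereal (\<phi> x)) y"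
  let ?F = "\<lambda>x. real_of_ereal (f x)" and ?G = "\<lambda>x. real_of_ereal (g x)"
  have F: "f x = ereal (?F x)" if "x \<in> edom f" for x
    by (rule ereal_real_on_edom) (use that assms in auto)
  have G: "g x = ereal (?G x)" if "x \<in> edom g" for x
    by (rule ereal_real_on_edom) (use that assms in auto)
  have y_dom: "y \<in> edom f" "y \<in> edom g"
    using y interior_subset by blast+
  have lipF: "lipschitz_near ?F y" and lipG: "lipschitz_near ?G y"
    using e_convex_lipschitz_near[of e f y] e_convex_lipschitz_near[of e' g y] assms eb eb' y by auto
  have lin: "linear \<phi>"
    using \<phi> by (simp add: dual_space_def)
  \<comment> \<open>Near \<open>y\<close> both functions are finite, so minimality can be read in
    the reals.\<close>
  have "\<forall>\<^sub>F x in nhds y. x \<in> interior (edom f) \<inter> interior (edom g)"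
    using y by (intro eventually_nhds_in_open) auto
  with min[unfolded local_minimum_point_def]
  have "\<forall>\<^sub>F x in nhds y. ?F y + ?G y - \<phi> y \<le> ?F x + ?G x - \<phi> x"
  proof eventually_elim
    case (elim x)
    then have "x \<in> edom f" "x \<in> edom g"
      using interior_subset by blast+
    with elim(1) y_dom have "ereal (?F y + ?G y - \<phi> y) \<le> ereal (?F x + ?G x - \<phi> x)"
      by (simp only: F[symmetric] G[symmetric] flip: plus_ereal.simps(1) ereal_minus(1))
    then show ?case
      by simp
  qed
  then have "\<phi> d \<le> clarke_derivative ?F y d + clarke_derivative ?G y d" for d
    by (rule local_minimum_clarke_derivative[OF lipF lipG lin])
  then obtain \<phi>1 \<phi>2 where \<phi>1: "linear \<phi>1" "\<phi>1 \<le> clarke_derivative ?F y"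
    and \<phi>2: "linear \<phi>2" "\<phi>2 \<le> clarke_derivative ?G y" and sum: "\<phi> = (\<lambda>x. \<phi>1 x + \<phi>2 x)"
    using linear_split_sublinear_sum[OF clarke_derivative_sublinear[OF lipF]
        clarke_derivative_sublinear[OF lipG] lin] by metis
  have conj1: "e_conjugate e y f \<phi>1 \<le> ereal (\<phi>1 y - ?F y)"
    by (rule e_conjugate_le_of_le_clarke_derivative) (use assms lipF y \<phi>1 in auto)
  have conj2: "e_conjugate e' y g \<phi>2 \<le> ereal (\<phi>2 y - ?G y)"
    by (rule e_conjugate_le_of_le_clarke_derivative) (use assms lipG y \<phi>2 in auto)
  have "inf_convolution (e_conjugate e y f) (e_conjugate e' y g) \<phi>
      \<le> lower_add (e_conjugate e y f \<phi>1) (e_conjugate e' y g \<phi>2)"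
    unfolding inf_convolution_def
    using linear_le_clarke_derivative_in_dual[OF lipF \<phi>1]
      linear_le_clarke_derivative_in_dual[OF lipG \<phi>2] sum
    by (intro Inf_lower) blast
  \<comment> \<open>\<open>lower_add\<close> never exceeds \<open>+\<close>.\<close>
  also have "\<dots> \<le> ereal (\<phi>1 y - ?F y) + ereal (\<phi>2 y - ?G y)"
    using add_mono[OF conj1 conj2] by (auto simp: lower_add_def)
  \<comment> \<open>Both errors vanish at \<open>(y, y)\<close>, so this is the term of the supremum
    at \<open>x = y\<close>.\<close>
  also have "\<dots> = ereal (\<phi> y) - (f y + g y) - (e (y, y) + e' (y, y))"
  proof -
    obtain a b where "f y = ereal a" "g y = ereal b"
      using F[OF y_dom(1)] G[OF y_dom(2)] by blast
    with assms(6,8) y_dom show ?thesis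
      by (simp add: sum)
  qed
  also have "\<dots> \<le> e_conjugate (\<lambda>p. e p + e' p) y (\<lambda>x. f x + g x) \<phi>"
    unfolding e_conjugate_def by (rule SUP_upper) simp
  finally show "e_conjugate (\<lambda>p. e p + e' p) y (\<lambda>x. f x + g x) \<phi>
    = inf_convolution (e_conjugate e y f) (e_conjugate e' y g) \<phi>"
    using le by simp
qed

end
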